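(* Let $G=(X,+,\leq)$ be an ordered group such that $\leq$ is a semiorder. If $H$ is a convex subgroup of $G$, then either $H\subseteq A(G)$, in which case $H$ is an antichain, or $I(G)(0)\subseteq H$. If the latter holds and $H$ is a normal subgroup of $G$, then $G/H$ is totally ordered and $G$ is the lexicographical sum of the cosets of $H$ (indexed by the chain $G/H$).
   Context: Groups are written additively but are not assumed abelian. An ordered group is a group with a partial order preserved by all left and right translations. An antichain is a set of pairwise incomparable elements. A subset is convex if it contains every element lying (for $\leq$) between two of its elements. $A(G):=\{x\in G:\mathbb{Z}x\text{ is an antichain in }G\}$, where $\mathbb{Z}x=\{nx:n\in\mathbb{Z}\}$. $I(G)(0)$ denotes the connected component of $0$ in the incomparability graph of $(X,\leq)$ (whose edges are the pairs of incomparable elements). For a normal subgroup $H$, $G/H$ carries the image relation: $a'\leq_H b'$ if $a\leq b$ for some $a\in a'$, $b\in b'$. The lexicographical sum of pairwise disjoint posets $P_i$ ($i\in I$) indexed by a poset $I$ is the order on the union in which $x\leq y$ iff $x,y$ lie in the same $P_i$ and $x\leq y$ there, or $x\in P_i$, $y\in P_j$ with $i<j$. An order is a semiorder if it embeds neither $2\oplus 2$ nor $3\oplus 1$, where $r\oplus s$ is the disjoint union of an $r$-element chain and an $s$-element chain with no comparabilities between them. *)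

theory Defs
  imports "HOL-Algebra.Coset" "HOL-Library.Disjoint_Sets"
begin

text \<open>
  Orders are reflexive relations, as in \<^const>\<open>partial_order_on\<close>. Groups are written in the
  multiplicative notation of HOL-Algebra and need not be commutative.
\<close>

subsection \<open>Posets\<close>

definition incomparability_graph :: "'a set \<Rightarrow> 'a rel \<Rightarrow> 'a rel" where
  "incomparability_graph A r =
     {(x, y). x \<in> A \<and> y \<in> A \<and> (x, y) \<notin> r \<and> (y, x) \<notin> r}"

definition incomparability_component :: "'a set \<Rightarrow> 'a rel \<Rightarrow> 'a \<Rightarrow> 'a set" where
  "incomparability_component A r a = (incomparability_graph A r)\<^sup>* `` {a}"

definition antichain :: "'a rel \<Rightarrow> 'a set \<Rightarrow> bool" where
  "antichain r S \<longleftrightarrow> (\<forall>x\<in>S. \<forall>y\<in>S. x \<noteq> y \<longrightarrow> (x, y) \<notin> r \<and> (y, x) \<notin> r)"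

definition order_convex :: "'a rel \<Rightarrow> 'a set \<Rightarrow> bool" where
  "order_convex r S \<longleftrightarrow> (\<forall>x\<in>S. \<forall>y\<in>S. \<forall>z. (x, z) \<in> r \<and> (z, y) \<in> r \<longrightarrow> z \<in> S)"

text \<open>For a (reflexive) order, \<^const>\<open>Field\<close> is its underlying set.\<close>

definition order_embeds :: "'b rel \<Rightarrow> 'a rel \<Rightarrow> bool" where
  "order_embeds s r \<longleftrightarrow>
     (\<exists>f. inj_on f (Field s) \<and> f ` Field s \<subseteq> Field r \<and>
          (\<forall>x\<in>Field s. \<forall>y\<in>Field s. (x, y) \<in> s \<longleftrightarrow> (f x, f y) \<in> r))"

definition order_disjoint_union :: "'a rel \<Rightarrow> 'b rel \<Rightarrow> ('a + 'b) rel" where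
  "order_disjoint_union r s = map_prod Inl Inl ` r \<union> map_prod Inr Inr ` s"

text \<open>\<^term>\<open>natLeq_on n\<close> is the \<^term>\<open>n\<close>-element chain on the naturals below \<^term>\<open>n\<close>.\<close>

definition semiorder_on :: "'a set \<Rightarrow> 'a rel \<Rightarrow> bool" where
  "semiorder_on A r \<longleftrightarrow> partial_order_on A r \<and>
     \<not> order_embeds (order_disjoint_union (natLeq_on 2) (natLeq_on 2)) r \<and>
     \<not> order_embeds (order_disjoint_union (natLeq_on 3) (natLeq_on 1)) r"

text \<open>
  The poset \<open>(X, r)\<close> is the lexicographical sum of the posets \<open>(P i, p i)\<close>, indexed by the
  poset \<open>(I, s)\<close>.
\<close>

definition is_lexicographical_sum ::
    "'a set \<Rightarrow> 'a rel \<Rightarrow> 'i set \<Rightarrow> 'i rel \<Rightarrow> ('i \<Rightarrow> 'a set) \<Rightarrow> ('i \<Rightarrow> 'a rel) \<Rightarrow> bool" where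
  "is_lexicographical_sum X r I s P p \<longleftrightarrow>
     partial_order_on I s \<and> (\<forall>i\<in>I. partial_order_on (P i) (p i)) \<and>
     disjoint_family_on P I \<and> X = (\<Union>i\<in>I. P i) \<and>
     r = {(x, y). (\<exists>i\<in>I. x \<in> P i \<and> y \<in> P i \<and> (x, y) \<in> p i) \<or>
                  (\<exists>i\<in>I. \<exists>j\<in>I. x \<in> P i \<and> y \<in> P j \<and> i \<noteq> j \<and> (i, j) \<in> s)}"

subsection \<open>Ordered groups\<close>

locale ordered_group = group G for G (structure) +
  fixes r :: "'a rel"
  assumes partial_order: "partial_order_on (carrier G) r"
    and left_mono: "\<lbrakk>(x, y) \<in> r; z \<in> carrier G\<rbrakk> \<Longrightarrow> (z \<otimes> x, z \<otimes> y) \<in> r"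
    and right_mono: "\<lbrakk>(x, y) \<in> r; z \<in> carrier G\<rbrakk> \<Longrightarrow> (x \<otimes> z, y \<otimes> z) \<in> r"

definition antichain_elements :: "('a, 'b) monoid_scheme \<Rightarrow> 'a rel \<Rightarrow> 'a set" where
  "antichain_elements G r =
     {x \<in> carrier G. antichain r (range (\<lambda>n::int. x [^]\<^bsub>G\<^esub> n))}"

definition quotient_rel :: "('a, 'b) monoid_scheme \<Rightarrow> 'a rel \<Rightarrow> 'a set \<Rightarrow> 'a set rel" where
  "quotient_rel G r H =
     {(a, b). a \<in> carrier (G Mod H) \<and> b \<in> carrier (G Mod H) \<and> (\<exists>x\<in>a. \<exists>y\<in>b. (x, y) \<in> r)}"

end

theory Submission
  imports Defs "HOL-Algebra.Generated_Groups"
begin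

text \<open>
  A comparable pair of distinct elements of \<open>H\<close> translates to some \<open>y \<in> H\<close> with \<open>\<one> < y\<close>, and
  such a \<open>y\<close> is not in \<open>A(G)\<close>. Hence \<open>H \<subseteq> A(G)\<close> means exactly that \<open>H\<close> is an antichain.

  Suppose that \<open>H\<close> does contain some \<open>y\<close> with \<open>\<one> < y\<close>. An element \<open>z\<close> incomparable to \<open>\<one>\<close> must be
  comparable to another member of the chain \<open>\<one> < y < y\<^sup>2\<close>, as a semiorder does not
  embed \<open>3 \<oplus> 1\<close>, and this forces \<open>z \<le> y\<^sup>2\<close>. The same bound for the inverse of \<open>z\<close> gives
  \<open>y\<^sup>-\<^sup>2 \<le> z\<close>, so \<open>z \<in> H\<close> by convexity. Translating by elements of \<open>H\<close>, every
  incomparability edge that starts in \<open>H\<close> also ends in \<open>H\<close>, hence \<open>H\<close> contains the component of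
  \<open>\<one>\<close> (\<open>incomparability_component_subset_convex_subgroup\<close>).

  Now suppose that \<open>H\<close> contains that component. Everything outside \<open>H\<close> is then comparable to
  \<open>\<one>\<close>, so elements of distinct cosets of \<open>H\<close> are comparable
  (\<open>distinct_cosets_comparable\<close>), which makes the quotient total. Convexity of \<open>H\<close> makes the
  image relation antisymmetric (\<open>quotient_rel_partial_order\<close>), so two distinct cosets
  cannot be compared in different directions through different representatives. The order
  between elements of distinct cosets thus depends on the cosets alone, which is the
  lexicographical decomposition.

  The part about cosets is carried out for the set of right cosets, which is the carrier
  of the quotient group when \<open>H\<close> is normal.
\<close>

section \<open>Chains of three elements in a semiorder\<close>

lemma Field_order_disjoint_union:
  "Field (order_disjoint_union r s) = Inl ` Field r \<union> Inr ` Field s"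
  by (force simp: order_disjoint_union_def Field_def Domain_iff Range_iff image_iff)

text \<open>
  If \<open>d\<close> were incomparable to \<open>a\<close>, \<open>b\<close> and \<open>c\<close>, then these four elements would form a copy of
  \<open>3 \<oplus> 1\<close>.
\<close>

lemma semiorder_chain3_comparable:
  assumes semi: "semiorder_on A r"
    and ab: "(a, b) \<in> r" "a \<noteq> b" and bc: "(b, c) \<in> r" "b \<noteq> c" and d: "d \<in> A"
  shows "\<exists>x\<in>{a, b, c}. (x, d) \<in> r \<or> (d, x) \<in> r"
proof (rule ccontr)
  assume "\<not> ?thesis"
  then have inc: "(a, d) \<notin> r" "(b, d) \<notin> r" "(c, d) \<notin> r" "(d, a) \<notin> r" "(d, b) \<notin> r" "(d, c) \<notin> r"
    by auto
  have po: "partial_order_on A r" using semi by (simp add: semiorder_on_def)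
  have sub: "r \<subseteq> A \<times> A" and re: "\<And>x. x \<in> A \<Longrightarrow> (x, x) \<in> r"
    and tr: "trans r" and an: "antisym r"
    using po by (auto simp: partial_order_on_def preorder_on_def refl_on_def)
  have A: "a \<in> A" "b \<in> A" "c \<in> A" using sub ab bc by auto
  have ac: "(a, c) \<in> r" using transD[OF tr ab(1) bc(1)] .
  have strict: "(b, a) \<notin> r" "(c, b) \<notin> r"
    using ab bc antisymD[OF an, of a b] antisymD[OF an, of b c] by auto
  have ca: "(c, a) \<notin> r" "a \<noteq> c"
    using strict ab bc transD[OF tr, of c a b] by auto
  have nd: "a \<noteq> d" "b \<noteq> d" "c \<noteq> d" using inc d re by auto
  define f :: "nat + nat \<Rightarrow> 'a"
    where "f = case_sum (\<lambda>i. if i = 0 then a else if i = 1 then b else c) (\<lambda>_. d)"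
  let ?s = "order_disjoint_union (natLeq_on 3) (natLeq_on 1)"
  have F: "Field ?s = {Inl 0, Inl 1, Inl 2, Inr 0}"
    unfolding Field_order_disjoint_union Field_natLeq_on by (auto simp: image_iff)
  have fv: "f (Inl 0) = a" "f (Inl 1) = b" "f (Inl 2) = c" "f (Inr 0) = d" "f (Inl (Suc 0)) = b"
    by (simp_all add: f_def)
  have "inj_on f (Field ?s)"
    unfolding F using ab bc ca nd by (auto simp: inj_on_def fv)
  moreover have "f ` Field ?s \<subseteq> Field r"
    unfolding F using A d re by (auto simp: fv intro: FieldI1)
  moreover have "\<forall>x\<in>Field ?s. \<forall>y\<in>Field ?s. (x, y) \<in> ?s \<longleftrightarrow> (f x, f y) \<in> r"
    unfolding F using inc strict ca ab bc ac A d re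
    by (auto simp: fv order_disjoint_union_def image_iff)
  ultimately have "order_embeds ?s r" unfolding order_embeds_def by blast
  then show False using semi by (simp add: semiorder_on_def)
qed

section \<open>Convex subgroups of an ordered group\<close>

context ordered_group
begin

lemma rel_carrier: "(x, y) \<in> r \<Longrightarrow> x \<in> carrier G \<and> y \<in> carrier G"
  and rel_refl: "x \<in> carrier G \<Longrightarrow> (x, x) \<in> r"
  and rel_trans: "(x, y) \<in> r \<Longrightarrow> (y, z) \<in> r \<Longrightarrow> (x, z) \<in> r"
  and rel_antisym: "(x, y) \<in> r \<Longrightarrow> (y, x) \<in> r \<Longrightarrow> x = y"
  using partial_order
  unfolding partial_order_on_def preorder_on_def refl_on_def trans_def antisym_def
  by blast+

lemma one_le_mult_inv_iff:
  assumes "x \<in> carrier G" "y \<in> carrier G"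
  shows "(\<one>, y \<otimes> inv x) \<in> r \<longleftrightarrow> (x, y) \<in> r"
  using assms right_mono[of \<one> "y \<otimes> inv x" x] right_mono[of x y "inv x"]
  by (auto simp: m_assoc)

lemma mult_inv_le_one_iff:
  assumes "x \<in> carrier G" "y \<in> carrier G"
  shows "(y \<otimes> inv x, \<one>) \<in> r \<longleftrightarrow> (y, x) \<in> r"
  using assms right_mono[of "y \<otimes> inv x" \<one> x] right_mono[of y x "inv x"]
  by (auto simp: m_assoc)

text \<open>
  A pair \<open>x < y\<close> in \<open>H\<close> would yield \<open>y x\<^sup>-\<^sup>1 \<in> H\<close> above \<open>\<one>\<close>, which already violates
  the antichain condition for the powers \<open>0\<close> and \<open>1\<close> of this element. In the other direction,
  the powers of an element of \<open>H\<close> stay in \<open>H\<close>.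
\<close>

lemma subgroup_subset_antichain_elements_iff:
  assumes H: "subgroup H G"
  shows "H \<subseteq> antichain_elements G r \<longleftrightarrow> antichain r H"
proof
  assume L: "H \<subseteq> antichain_elements G r"
  have False if xy: "x \<in> H" "y \<in> H" "x \<noteq> y" "(x, y) \<in> r" for x y
  proof -
    have c: "x \<in> carrier G" "y \<in> carrier G" using xy H by (auto dest: subgroup.subset)
    let ?z = "y \<otimes> inv x"
    have "?z \<in> H" using H xy by (simp add: subgroup.m_closed subgroup.m_inv_closed)
    then have ac: "antichain r (range (\<lambda>n::int. ?z [^] n))"
      using L by (auto simp: antichain_elements_def)
    have "?z = ?z [^] (1::int)" "\<one> = ?z [^] (0::int)" using c by simp_all
    then have "?z \<in> range (\<lambda>n::int. ?z [^] n)" "\<one> \<in> range (\<lambda>n::int. ?z [^] n)"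
      by blast+
    moreover have "(\<one>, ?z) \<in> r" using c xy by (simp add: one_le_mult_inv_iff)
    ultimately have "?z = \<one>" using ac unfolding antichain_def by blast
    then show False using c xy by (metis inv_equality inv_closed inv_inv)
  qed
  then show "antichain r H" unfolding antichain_def by blast
next
  assume R: "antichain r H"
  have "x [^] n \<in> H" if "x \<in> H" for x and n :: int
    using H that by (rule subgroup_int_pow_closed)
  then show "H \<subseteq> antichain_elements G r"
    using R H unfolding antichain_elements_def antichain_def
    by (auto dest: subgroup.subset)
qed

text \<open>
  In the chain \<open>\<one> < y < y\<^sup>2\<close>, some member other than \<open>\<one>\<close> is comparable to \<open>z\<close>; it cannot lie
  below \<open>z\<close>, since then \<open>\<one>\<close> would, too.
\<close>

lemma semiorder_incomparable_le_square:
  assumes semi: "semiorder_on (carrier G) r"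
    and y: "(\<one>, y) \<in> r" "y \<noteq> \<one>"
    and z: "z \<in> carrier G" "(\<one>, z) \<notin> r" "(z, \<one>) \<notin> r"
  shows "(z, y \<otimes> y) \<in> r"
proof -
  have c: "y \<in> carrier G" using y rel_carrier by blast
  have yy: "(y, y \<otimes> y) \<in> r" using left_mono[OF y(1) c] c by simp
  have "y \<noteq> y \<otimes> y" using c y by simp
  then obtain x where x: "x \<in> {\<one>, y, y \<otimes> y}" "(x, z) \<in> r \<or> (z, x) \<in> r"
    using semiorder_chain3_comparable[OF semi y(1) _ yy _ z(1)] y(2) by blast
  have "(\<one>, x) \<in> r" using x y yy rel_refl rel_trans by blast
  then have "(z, x) \<in> r" "x \<noteq> \<one>" using x z rel_trans by blast+
  then show ?thesis using x yy rel_trans by blast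
qed

text \<open>
  With \<open>y \<in> H\<close> above \<open>\<one>\<close>, the preceding bound applied to \<open>z\<close> and to its inverse encloses each
  \<open>z\<close> incomparable to \<open>\<one>\<close> between two elements of \<open>H\<close>. Right translations preserve
  incomparability, which extends this from the neighbours of \<open>\<one>\<close> to all paths from \<open>\<one>\<close>.
\<close>

lemma incomparability_component_subset_convex_subgroup:
  assumes semi: "semiorder_on (carrier G) r"
    and H: "subgroup H G" and conv: "order_convex r H" and nac: "\<not> antichain r H"
  shows "incomparability_component (carrier G) r \<one> \<subseteq> H"
proof -
  note Hc = subgroup.m_closed[OF H] subgroup.m_inv_closed[OF H] subgroup.mem_carrier[OF H]
  obtain a b where ab: "a \<in> H" "b \<in> H" "a \<noteq> b" "(a, b) \<in> r"
    using nac unfolding antichain_def by blast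
  define y where "y = b \<otimes> inv a"
  have y: "y \<in> H" "(\<one>, y) \<in> r" unfolding y_def
    using ab Hc one_le_mult_inv_iff by auto
  have y1: "y \<noteq> \<one>" unfolding y_def
    using ab Hc by (metis inv_equality inv_closed inv_inv)
  have yc: "y \<in> carrier G" using y Hc by blast
  have inc: "z \<in> H" if z: "z \<in> carrier G" "(\<one>, z) \<notin> r" "(z, \<one>) \<notin> r" for z
  proof -
    have up: "(z, y \<otimes> y) \<in> r"
      using semiorder_incomparable_le_square[OF semi y(2) y1 z] .
    have "(\<one>, inv z) \<notin> r" "(inv z, \<one>) \<notin> r"
      using z one_le_mult_inv_iff[of z \<one>] mult_inv_le_one_iff[of z \<one>] by auto
    then have "(inv z, y \<otimes> y) \<in> r"
      using semiorder_incomparable_le_square[OF semi y(2) y1] z by simp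
    \<comment> \<open>Multiply by \<open>z\<close> on the left and by the inverse of \<open>y\<^sup>2\<close> on the right.\<close>
    from right_mono[OF left_mono[OF this z(1)], of "inv (y \<otimes> y)"]
    have "(inv (y \<otimes> y), z) \<in> r" using z yc by (simp add: m_assoc del: inv_mult_group)
    with up show ?thesis
      using conv y Hc unfolding order_convex_def by blast
  qed
  have "x \<in> H" if "(\<one>, x) \<in> (incomparability_graph (carrier G) r)\<^sup>*" for x
    using that
  proof (induction rule: rtrancl_induct)
    case base
    show ?case using H by (rule subgroup.one_closed)
  next
    case (step h z)
    have hz: "h \<in> carrier G" "z \<in> carrier G" "(h, z) \<notin> r" "(z, h) \<notin> r"
      using step.hyps by (auto simp: incomparability_graph_def)
    have "z \<otimes> inv h \<in> H"
      using hz by (intro inc) (auto simp: one_le_mult_inv_iff mult_inv_le_one_iff)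
    then have "z \<otimes> inv h \<otimes> h \<in> H" using step.IH Hc by blast
    then show ?case using hz by (simp add: m_assoc)
  qed
  then show ?thesis unfolding incomparability_component_def by blast
qed

section \<open>The order on the cosets\<close>

lemma rcosets_mult_closed:
  assumes "subgroup H G" "c \<in> rcosets H" "x \<in> c" "h \<in> H"
  shows "h \<otimes> x \<in> c"
proof -
  obtain g h' where g: "g \<in> carrier G" "c = H #> g" and h': "h' \<in> H" "x = h' \<otimes> g"
    using assms unfolding RCOSETS_def r_coset_def by blast
  have "h \<otimes> x = (h \<otimes> h') \<otimes> g"
    using g h' assms(4) subgroup.mem_carrier[OF assms(1)] by (simp add: m_assoc)
  then show ?thesis
    using g h' subgroup.m_closed[OF assms(1,4) h'(1)] unfolding r_coset_def by blast
qed

lemma rcosets_transitive: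
  assumes "subgroup H G" "c \<in> rcosets H" "x \<in> c" "x' \<in> c"
  shows "\<exists>h\<in>H. x' = h \<otimes> x"
proof -
  have "x \<in> carrier G" "c = H #> x"
    using assms rcosets_part_G[OF assms(1)] repr_independence[OF _ _ assms(1)]
    by (auto simp: RCOSETS_def)
  then show ?thesis using assms by (auto simp: r_coset_def)
qed

lemma rcosets_eq_if_meet:
  assumes "subgroup H G" "c \<in> rcosets H" "d \<in> rcosets H" "x \<in> c" "x \<in> d"
  shows "c = d"
  using rcos_disjoint[OF assms(1)] assms by (auto simp: pairwise_def disjnt_def)

lemma rcosets_convex:
  assumes H: "subgroup H G" and conv: "order_convex r H" and c: "c \<in> rcosets H"
  shows "order_convex r c"
  unfolding order_convex_def
proof (intro ballI allI impI)
  fix x y z assume x: "x \<in> c" and y: "y \<in> c" and z: "(x, z) \<in> r \<and> (z, y) \<in> r"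
  have cs: "x \<in> carrier G" "y \<in> carrier G" "z \<in> carrier G" using z rel_carrier by blast+
  obtain h where h: "h \<in> H" "y = h \<otimes> x" using rcosets_transitive[OF H c x y] by blast
  have hc: "h \<in> carrier G" using subgroup.mem_carrier[OF H h(1)] .
  have "(\<one>, z \<otimes> inv x) \<in> r" using cs z by (simp add: one_le_mult_inv_iff)
  moreover have "(z \<otimes> inv x, h) \<in> r"
    using right_mono[of z y "inv x"] z cs h hc by (simp add: m_assoc)
  ultimately have "z \<otimes> inv x \<in> H"
    using conv h subgroup.one_closed[OF H] unfolding order_convex_def by blast
  from rcosets_mult_closed[OF H c x this] show "z \<in> c" using cs by (simp add: m_assoc)
qed

text \<open>
  Left multiplication by elements of \<open>H\<close> acts on each right coset, transitively and
  monotonically. It moves a pair witnessing \<open>(a, b)\<close> to one that starts at the prescribed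
  element of \<open>a\<close>. This makes chains of comparisons between cosets composable.
\<close>

lemma quotient_rel_upward:
  assumes H: "subgroup H G" and ab: "(a, b) \<in> quotient_rel G r H" and x: "x \<in> a"
  shows "\<exists>y\<in>b. (x, y) \<in> r"
proof -
  have cos: "a \<in> rcosets H" "b \<in> rcosets H"
    using ab unfolding quotient_rel_def FactGroup_def by simp_all
  obtain x' y' where xy: "x' \<in> a" "y' \<in> b" "(x', y') \<in> r"
    using ab unfolding quotient_rel_def by blast
  obtain h where h: "h \<in> H" "x = h \<otimes> x'"
    using rcosets_transitive[OF H cos(1) xy(1) x] by blast
  have "(x, h \<otimes> y') \<in> r"
    unfolding h(2) using xy(3) subgroup.mem_carrier[OF H h(1)] by (rule left_mono)
  then show ?thesis using rcosets_mult_closed[OF H cos(2) xy(2) h(1)] by blast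
qed

text \<open>
  Convexity of the cosets yields antisymmetry: from \<open>x \<le> y \<le> x'\<close> with \<open>x\<close>, \<open>x'\<close> in the same
  coset, \<open>y\<close> lies in that coset, too. Such a chain exists because the comparison \<open>y \<le> x'\<close> can be made to start at
  the element \<open>y\<close> reached by the first one.
\<close>

lemma quotient_rel_partial_order:
  assumes H: "subgroup H G" and conv: "order_convex r H"
  shows "partial_order_on (rcosets H) (quotient_rel G r H)"
proof -
  let ?q = "quotient_rel G r H"
  have sub: "?q \<subseteq> (rcosets H) \<times> (rcosets H)"
    by (auto simp: quotient_rel_def FactGroup_def)
  have "refl_on (rcosets H) ?q"
  proof (rule refl_onI)
    fix a assume a: "a \<in> rcosets H"
    then obtain x where "x \<in> carrier G" "x \<in> a"
      using rcos_self[OF _ H] by (auto simp: RCOSETS_def)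
    then show "(a, a) \<in> ?q" using a rel_refl by (auto simp: quotient_rel_def FactGroup_def)
  qed
  moreover have "trans ?q"
  proof (rule transI)
    fix a b c assume ab: "(a, b) \<in> ?q" and bc: "(b, c) \<in> ?q"
    obtain x y where xy: "x \<in> a" "y \<in> b" "(x, y) \<in> r"
      using ab unfolding quotient_rel_def by blast
    obtain z where "z \<in> c" "(y, z) \<in> r" using quotient_rel_upward[OF H bc xy(2)] by blast
    then show "(a, c) \<in> ?q"
      using ab bc xy rel_trans unfolding quotient_rel_def by blast
  qed
  moreover have "antisym ?q"
  proof (rule antisymI)
    fix a b assume ab: "(a, b) \<in> ?q" and ba: "(b, a) \<in> ?q"
    obtain x y where xy: "x \<in> a" "y \<in> b" "(x, y) \<in> r"
      using ab unfolding quotient_rel_def by blast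
    obtain x' where "x' \<in> a" "(y, x') \<in> r" using quotient_rel_upward[OF H ba xy(2)] by blast
    then have "y \<in> a"
      using rcosets_convex[OF H conv] sub ab xy unfolding order_convex_def by blast
    then show "a = b" using rcosets_eq_if_meet[OF H] sub ab xy by blast
  qed
  ultimately show ?thesis using sub by (simp add: partial_order_on_def preorder_on_def)
qed

text \<open>
  For incomparable \<open>x\<close> and \<open>y\<close>, the element \<open>y x\<^sup>-\<^sup>1\<close> is a neighbour of \<open>\<one>\<close> in the
  incomparability graph and so lies in \<open>H\<close>, that is, \<open>x\<close> and \<open>y\<close> share a right coset.
\<close>

lemma distinct_cosets_comparable:
  assumes H: "subgroup H G"
    and comp: "incomparability_component (carrier G) r \<one> \<subseteq> H"
    and ab: "a \<in> rcosets H" "b \<in> rcosets H" "a \<noteq> b" and x: "x \<in> a" and y: "y \<in> b"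
  shows "(x, y) \<in> r \<or> (y, x) \<in> r"
proof (rule ccontr)
  assume inc: "\<not> ?thesis"
  have c: "x \<in> carrier G" "y \<in> carrier G" using ab x y rcosets_part_G[OF H] by blast+
  have "(\<one>, y \<otimes> inv x) \<in> incomparability_graph (carrier G) r"
    using c inc by (simp add: incomparability_graph_def one_le_mult_inv_iff mult_inv_le_one_iff)
  then have "y \<otimes> inv x \<in> H" using comp by (auto simp: incomparability_component_def)
  from rcosets_mult_closed[OF H ab(1) x this] have "y \<in> a" using c by (simp add: m_assoc)
  then show False using rcosets_eq_if_meet[OF H] ab y by blast
qed

lemma quotient_rel_linear_order:
  assumes H: "subgroup H G" and conv: "order_convex r H"
    and comp: "incomparability_component (carrier G) r \<one> \<subseteq> H"
  shows "linear_order_on (rcosets H) (quotient_rel G r H)"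
proof -
  have "(a, b) \<in> quotient_rel G r H \<or> (b, a) \<in> quotient_rel G r H"
    if ab: "a \<in> rcosets H" "b \<in> rcosets H" "a \<noteq> b" for a b
  proof -
    obtain x y where xy: "x \<in> a" "y \<in> b"
      using ab(1,2) rcos_self[OF _ H] unfolding RCOSETS_def by blast
    show ?thesis using distinct_cosets_comparable[OF H comp ab xy] ab(1,2) xy
      by (auto simp: quotient_rel_def FactGroup_def)
  qed
  then show ?thesis
    using quotient_rel_partial_order[OF H conv] by (simp add: linear_order_on_def total_on_def)
qed

lemma lexicographical_sum_of_cosets:
  assumes H: "subgroup H G" and conv: "order_convex r H"
    and comp: "incomparability_component (carrier G) r \<one> \<subseteq> H"
  shows "is_lexicographical_sum (carrier G) r
           (rcosets H) (quotient_rel G r H) (\<lambda>c. c) (\<lambda>c. Restr r c)"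
proof -
  let ?q = "quotient_rel G r H"
  have q: "partial_order_on (rcosets H) ?q" using quotient_rel_partial_order[OF H conv] .
  have un: "carrier G = (\<Union>c\<in>rcosets H. c)" using rcosets_part_G[OF H] by simp
  have qI: "(a, b) \<in> ?q"
    if "a \<in> rcosets H" "b \<in> rcosets H" "x \<in> a" "y \<in> b" "(x, y) \<in> r" for a b x y
    using that by (auto simp: quotient_rel_def FactGroup_def)
  have "partial_order_on c (Restr r c)" if "c \<in> rcosets H" for c
  proof -
    have "c \<subseteq> carrier G" using un that by blast
    then show ?thesis
      using rel_refl rel_trans rel_antisym
      unfolding partial_order_on_def preorder_on_def refl_on_def trans_def antisym_def
      by blast
  qed
  moreover have "disjoint_family_on (\<lambda>c. c) (rcosets H)"
    using rcosets_eq_if_meet[OF H] unfolding disjoint_family_on_def by blast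
  moreover have "(x, y) \<in> r \<longleftrightarrow> (\<exists>i\<in>rcosets H. x \<in> i \<and> y \<in> i \<and> (x, y) \<in> Restr r i) \<or>
      (\<exists>i\<in>rcosets H. \<exists>j\<in>rcosets H. x \<in> i \<and> y \<in> j \<and> i \<noteq> j \<and> (i, j) \<in> ?q)"
    (is "_ \<longleftrightarrow> ?within \<or> ?across") for x y
  proof
    assume xy: "(x, y) \<in> r"
    obtain i where i: "i \<in> rcosets H" "x \<in> i" using rel_carrier[OF xy] un by blast
    obtain j where j: "j \<in> rcosets H" "y \<in> j" using rel_carrier[OF xy] un by blast
    show "?within \<or> ?across"
    proof (cases "i = j")
      case True
      then have ?within using i j xy by blast
      then show ?thesis ..
    next
      case False
      then have ?across using i j qI[OF i(1) j(1) i(2) j(2) xy] by blast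
      then show ?thesis ..
    qed
  next
    assume "?within \<or> ?across"
    then show "(x, y) \<in> r"
    proof
      assume ?across
      then obtain i j where ij: "i \<in> rcosets H" "j \<in> rcosets H" "i \<noteq> j" "(i, j) \<in> ?q"
        and xy: "x \<in> i" "y \<in> j" by blast
      \<comment> \<open>The opposite comparison would reverse \<open>(i, j)\<close> in the antisymmetric quotient.\<close>
      have "(y, x) \<notin> r"
        using qI[OF ij(2,1) xy(2,1)] ij(3,4) q unfolding partial_order_on_def antisym_def by blast
      then show "(x, y) \<in> r" using distinct_cosets_comparable[OF H comp ij(1-3) xy] by blast
    qed blast
  qed
  ultimately show ?thesis
    using q un unfolding is_lexicographical_sum_def by (intro conjI ballI set_eqI) auto
qed

end

theorem theorem19:
  fixes G :: "('a, 'b) monoid_scheme" and r :: "'a rel" and H :: "'a set"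
  assumes "ordered_group G r"
    and "semiorder_on (carrier G) r"
    and "subgroup H G"
    and "order_convex r H"
  shows "(H \<subseteq> antichain_elements G r \<or>
          incomparability_component (carrier G) r \<one>\<^bsub>G\<^esub> \<subseteq> H) \<and>
         (H \<subseteq> antichain_elements G r \<longrightarrow> antichain r H) \<and>
         (incomparability_component (carrier G) r \<one>\<^bsub>G\<^esub> \<subseteq> H \<and> H \<lhd> G \<longrightarrow>
            linear_order_on (carrier (G Mod H)) (quotient_rel G r H) \<and>
            is_lexicographical_sum (carrier G) r
              (carrier (G Mod H)) (quotient_rel G r H) (\<lambda>c. c) (\<lambda>c. Restr r c))"
proof -
  interpret ordered_group G r by fact
  have carrier_quotient: "carrier (G Mod H) = rcosets\<^bsub>G\<^esub> H" by (simp add: FactGroup_def)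
  then show ?thesis
    using subgroup_subset_antichain_elements_iff[OF assms(3)]
      incomparability_component_subset_convex_subgroup[OF assms(2-4)]
      quotient_rel_linear_order[OF assms(3,4)] lexicographical_sum_of_cosets[OF assms(3,4)]
    unfolding carrier_quotient by blast
qed

end
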